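(* Let $r\ge2$. Any connected ($r$-uniform) $r$-partite hypergraph $\mathbb H=(V,\mathcal H)$ is non-stabilizable.
   Context: A hypergraph $\mathbb H=(V,\mathcal H)$ consists of a finite node set $V$ and a finite set $\mathcal H$ of subsets of $V$ (hyperedges) with union $V$. All hypergraphs are assumed simple (no hyperedge is contained in another one) and connected (the graph whose vertices are the hyperedges, with two hyperedges adjacent when they intersect, is connected). An $r$-uniform hypergraph (all hyperedges have cardinality $r$, $r\ge2$) is $r$-partite if there is a partition $V_1,\dots,V_r$ of $V$ such that $|H\cap V_i|=1$ for every $H\in\mathcal H$ and every $i\in\{1,\dots,r\}$. $\mathscr M(V)$ is the set of probability measures $\mu$ on $V$ with $\mu(i)>0$ for all $i$. Matching model $(\mathbb H,\Phi,\mu)$: at each time $n\ge1$ one item enters; its class $C_n\in V$ is drawn from $\mu$, i.i.d. If the buffer contains a set of items whose classes form, together with $C_n$, a hyperedge (one item per class), the policy $\Phi$ selects one such set and these items leave immediately together with the incoming item (a match is always performed whenever possible); otherwise the incoming item is stored. $W_n$ is the word over $V$ listing the classes of unmatched items after the arrival at time $n$, in order of arrival; it takes values in the set of words in which, for each hyperedge, some class of the hyperedge does not occur. $\Phi$ is admissible if the choice of the match depends solely on the queue detail (the word) upon arrival and the incoming class, and possibly on an independent uniform draw in case of a tie; then $(W_n)$ is a Markov chain. The model is stable if $(W_n)$ is positive recurrent; $\mathrm{Stab}(\mathbb H,\Phi)$ is the set of $\mu\in\mathscr M(V)$ for which it is stable. $\mathbb H$ is non-stabilizable if $\mathrm{Stab}(\mathbb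 H,\Phi)=\emptyset$ for every admissible $\Phi$. *)

theory Defs
  imports "HOL-Probability.Probability"
begin

subsection \<open>Hypergraphs\<close>

definition hypergraph :: "'v set \<Rightarrow> 'v set set \<Rightarrow> bool" where
  "hypergraph V E \<longleftrightarrow> finite V \<and> finite E \<and> \<Union>E = V"

definition simple_hypergraph :: "'v set set \<Rightarrow> bool" where
  "simple_hypergraph E \<longleftrightarrow> (\<forall>H\<in>E. \<forall>H'\<in>E. \<not> H \<subset> H')"

definition connected_hypergraph :: "'v set set \<Rightarrow> bool" where
  "connected_hypergraph E \<longleftrightarrow>
     (\<forall>H\<in>E. \<forall>H'\<in>E. (H, H') \<in> {(A, B). A \<in> E \<and> B \<in> E \<and> A \<inter> B \<noteq> {}}\<^sup>*)"

definition uniform_hypergraph :: "nat \<Rightarrow> 'v set set \<Rightarrow> bool" where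
  "uniform_hypergraph r E \<longleftrightarrow> (\<forall>H\<in>E. card H = r)"

definition partite_hypergraph :: "nat \<Rightarrow> 'v set \<Rightarrow> 'v set set \<Rightarrow> bool" where
  "partite_hypergraph r V E \<longleftrightarrow>
     (\<exists>P :: nat \<Rightarrow> 'v set. inj_on P {1..r} \<and> partition_on V (P ` {1..r}) \<and>
        (\<forall>H\<in>E. \<forall>i\<in>{1..r}. card (H \<inter> P i) = 1))"


subsection \<open>The matching model\<close>

text \<open>Queue details: words over the nodes, oldest item first.\<close>

definition queue_words :: "'v set \<Rightarrow> 'v set set \<Rightarrow> 'v list set" where
  "queue_words V E = {w \<in> lists V. \<forall>H\<in>E. \<not> H \<subseteq> set w}"

text \<open>Items are identified by their positions in the word, so that a policy may distinguish
  stored items of the same class (e.g. oldest or most recent item first). An element of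
  \<open>possible_matches E w c\<close> is a set of positions of \<open>w\<close> which together with the incoming
  item of class \<open>c\<close> forms a hyperedge, one item per class.\<close>

definition possible_matches :: "'v set set \<Rightarrow> 'v list \<Rightarrow> 'v \<Rightarrow> nat set set" where
  "possible_matches E w c =
     {I. I \<subseteq> {..<length w} \<and> inj_on (nth w) I \<and> c \<notin> nth w ` I \<and> insert c (nth w ` I) \<in> E}"

text \<open>The selected match is a function of the word, the incoming class and a draw \<open>u\<close> from the
  uniform distribution on \<open>[0,1]\<close>. The law of the selected match given the word and the incoming
  class can thereby be any distribution on the possible matches; this covers in particular
  deterministic policies and a uniform choice among tied matches.\<close>

type_synonym 'v policy = "'v list \<Rightarrow> 'v \<Rightarrow> real \<Rightarrow> nat set"

definition unif01 :: "real measure" where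
  "unif01 = restrict_space lborel {0..1}"

definition admissible :: "'v set \<Rightarrow> 'v set set \<Rightarrow> 'v policy \<Rightarrow> bool" where
  "admissible V E \<Phi> \<longleftrightarrow>
     (\<forall>w\<in>queue_words V E. \<forall>c\<in>V. possible_matches E w c \<noteq> {} \<longrightarrow>
        \<Phi> w c \<in> measurable unif01 (count_space (possible_matches E w c)))"

definition queue_step :: "'v set set \<Rightarrow> 'v policy \<Rightarrow> 'v list \<Rightarrow> 'v \<times> real \<Rightarrow> 'v list" where
  "queue_step E \<Phi> w = (\<lambda>(c, u).
     if possible_matches E w c = {} then w @ [c] else nths w (- \<Phi> w c u))"

text \<open>\<open>\<omega> n\<close> is the pair of class and draw of the item entering at time \<open>n + 1\<close>; \<open>w\<close> is the
  initial queue detail.\<close>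

primrec queue :: "'v set set \<Rightarrow> 'v policy \<Rightarrow> 'v list \<Rightarrow> (nat \<Rightarrow> 'v \<times> real) \<Rightarrow> nat \<Rightarrow> 'v list" where
  "queue E \<Phi> w \<omega> 0 = w"
| "queue E \<Phi> w \<omega> (Suc n) = queue_step E \<Phi> (queue E \<Phi> w \<omega> n) (\<omega> n)"

definition full_support :: "'v set \<Rightarrow> 'v pmf set" where
  "full_support V = {\<mu>. set_pmf \<mu> = V}"

text \<open>The law \<open>\<mu>\<close> is restricted to its support \<open>V\<close>, so that the classes lie in \<open>V\<close> surely and
  the return times below are measurable even if the type \<open>'v\<close> is uncountable.\<close>

definition arrivals :: "'v set \<Rightarrow> 'v pmf \<Rightarrow> (nat \<Rightarrow> 'v \<times> real) measure" where
  "arrivals V \<mu> = PiM UNIV (\<lambda>_. restrict_space (measure_pmf \<mu>) V \<Otimes>\<^sub>M unif01)"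

text \<open>The infimum of the empty set is \<open>\<infinity>\<close>: a path that never returns has infinite return time.\<close>

definition return_time ::
  "'v set set \<Rightarrow> 'v policy \<Rightarrow> 'v list \<Rightarrow> (nat \<Rightarrow> 'v \<times> real) \<Rightarrow> ennreal" where
  "return_time E \<Phi> w \<omega> = (INF n\<in>{n. n \<ge> 1 \<and> queue E \<Phi> w \<omega> n = w}. of_nat n)"

text \<open>Stability is positive recurrence of the chain of queue details: every state has finite
  expected return time (hence also almost surely finite return time).\<close>

definition stable ::
  "'v set \<Rightarrow> 'v set set \<Rightarrow> 'v policy \<Rightarrow> 'v pmf \<Rightarrow> bool" where
  "stable V E \<Phi> \<mu> \<longleftrightarrow>
     (\<forall>w\<in>queue_words V E. (\<integral>\<^sup>+ \<omega>. return_time E \<Phi> w \<omega> \<partial>arrivals V \<mu>) < \<infinity>)"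

definition Stab :: "'v set \<Rightarrow> 'v set set \<Rightarrow> 'v policy \<Rightarrow> 'v pmf set" where
  "Stab V E \<Phi> = {\<mu> \<in> full_support V. stable V E \<Phi> \<mu>}"

definition non_stabilizable :: "'v set \<Rightarrow> 'v set set \<Rightarrow> bool" where
  "non_stabilizable V E \<longleftrightarrow> (\<forall>\<Phi>. admissible V E \<Phi> \<longrightarrow> Stab V E \<Phi> = {})"

end

theory Submission
  imports Defs
begin

text \<open>
  Let \<open>f\<close> be \<open>1\<close> on the first part, \<open>- 1\<close> on the second part and \<open>0\<close> on the others. Every
  hyperedge has one node in each part, so the total weight of the items involved in a match is
  zero. Whatever the policy does, the total weight of the buffer is therefore the sum of the
  weights of all arrivals so far (\<open>queue_weight\<close>), that is, a random walk with steps in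
  \<open>{-1, 0, 1}\<close> on which the policy has no influence. A queue that starts empty can be empty only
  when this walk is at zero, so its return time is at least that of the walk.

  The walk is not positive recurrent for any \<open>\<mu>\<close>: it is transient if its drift is nonzero and
  null recurrent if the drift is zero. Both cases are covered by one argument
  (\<open>nonneg_drift_walk_infinite_expected_return\<close>). Exchanging \<open>f\<close> and \<open>- f\<close> if necessary, the
  drift is nonnegative. On the event that the first step is \<open>+1\<close>, stop the walk when it returns
  to zero. The stopped walk is a submartingale, whose mean stays above the probability of the
  event; it is dominated by the return time \<open>T\<close>, since it gains at most one per step; and it tends
  to zero when \<open>T\<close> is finite. If \<open>T\<close> had finite expectation, dominated convergence would send its
  mean to zero, a contradiction.

  The same argument rules out stability whenever no hyperedge is empty and some weight with values in \<open>{-1, 0, 1}\<close>, not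
  identically zero on the nodes, sums to zero on every hyperedge
  (\<open>balanced_weight_non_stabilizable\<close>).
\<close>

section \<open>Random walks with nonnegative drift\<close>

text \<open>Optional stopping without a stopping time: instead of the walk stopped at \<open>T\<close>, the proof
  follows the variables that equal the walk as long as it has been positive since time \<open>1\<close> and
  are zero afterwards. As the steps are at least \<open>-1\<close>, a positive integer walk that ceases to be
  positive does so exactly at zero, so nothing is lost by this cut-off.\<close>

lemma (in prob_space) nonneg_drift_walk_infinite_expected_return:
  fixes X :: "nat \<Rightarrow> 'a \<Rightarrow> real"
  assumes indep: "indep_vars (\<lambda>_. borel) X UNIV"
    and range: "\<And>n \<omega>. \<omega> \<in> space M \<Longrightarrow> X n \<omega> \<in> {-1, 0, 1}"
    and drift: "\<And>n. expectation (X n) \<ge> 0"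
    and up: "prob {\<omega> \<in> space M. X 0 \<omega> = 1} > 0"
  shows "(\<integral>\<^sup>+ \<omega>. (INF n\<in>{n. n \<ge> 1 \<and> (\<Sum>k<n. X k \<omega>) = 0}. of_nat n) \<partial>M) = \<infinity>"
proof (rule ccontr)
  define T :: "'a \<Rightarrow> ennreal"
    where "T \<omega> = (INF n\<in>{n. n \<ge> 1 \<and> (\<Sum>k<n. X k \<omega>) = 0}. of_nat n)" for \<omega>
  assume "\<not> ?thesis"
  then have T_fin: "(\<integral>\<^sup>+ \<omega>. T \<omega> \<partial>M) < \<infinity>"
    by (simp add: T_def top.not_eq_extremum)
  have X_meas [measurable]: "X n \<in> borel_measurable M" for n
    using indep by (auto simp: indep_vars_def)
  define S where "S n \<omega> = (\<Sum>k<n. X k \<omega>)" for n \<omega>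
  have S_meas [measurable]: "S n \<in> borel_measurable M" for n
    unfolding S_def by measurable
  \<comment> \<open>An infimum over a fixed countable index set, from which measurability of \<open>T\<close> can be read off.\<close>
  have T_alt: "T \<omega> = (INF n. if n \<ge> 1 \<and> S n \<omega> = 0 then of_nat n else \<infinity>)" for \<omega>
  proof (rule antisym)
    show "T \<omega> \<le> (INF n. if n \<ge> 1 \<and> S n \<omega> = 0 then of_nat n else \<infinity>)"
      unfolding T_def S_def by (rule INF_greatest) (simp add: INF_lower)
    show "(INF n. if n \<ge> 1 \<and> S n \<omega> = 0 then of_nat n else \<infinity>) \<le> T \<omega>"
      unfolding T_def S_def
    proof (rule INF_greatest)
      fix m assume "m \<in> {n. n \<ge> 1 \<and> (\<Sum>k<n. X k \<omega>) = 0}"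
      then show "(INF n. if n \<ge> 1 \<and> (\<Sum>k<n. X k \<omega>) = 0 then of_nat n else \<infinity>) \<le> (of_nat m :: ennreal)"
        by (intro INF_lower2[of m]) auto
    qed
  qed
  have T_meas [measurable]: "T \<in> borel_measurable M"
    unfolding T_alt[abs_def] by measurable
  define alive where "alive n \<omega> \<longleftrightarrow> (\<forall>k\<in>{1..n}. S k \<omega> > 0)" for n \<omega>
  have alive_meas [measurable]: "Measurable.pred M (alive n)" for n
    unfolding alive_def[abs_def] by measurable
  \<comment> \<open>The index is shifted by one: the walk starts at zero and can be positive only from time 1 on.\<close>
  define G where "G n \<omega> = (if alive (Suc n) \<omega> then S (Suc n) \<omega> else 0)" for n \<omega>
  have G_meas [measurable]: "G n \<in> borel_measurable M" for n
    unfolding G_def[abs_def] by measurable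
  have S_Ints: "S n \<omega> \<in> \<int>" if "\<omega> \<in> space M" for n \<omega>
    unfolding S_def using range[OF that] by (intro Ints_sum) (metis Ints_0 Ints_1 Ints_minus insertE empty_iff)
  have S_le: "S n \<omega> \<le> of_nat n" if "\<omega> \<in> space M" for n \<omega>
  proof -
    have "X k \<omega> \<le> 1" for k using range[OF that, of k] by auto
    then have "S n \<omega> \<le> (\<Sum>k<n. 1)" unfolding S_def by (intro sum_mono)
    then show ?thesis by simp
  qed
  have G_nonneg: "G n \<omega> \<ge> 0" for n \<omega>
    unfolding G_def alive_def by (auto simp: less_imp_le)
  have G_le: "G n \<omega> \<le> Suc n" if "\<omega> \<in> space M" for n \<omega>
    unfolding G_def using S_le[OF that, of "Suc n"] by simp
  have G_int: "integrable M (G n)" for n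
    using G_le G_nonneg by (intro integrable_const_bound[where B = "Suc n"] AE_I2) auto
  have alive_indep: "indep_var borel (\<lambda>\<omega>. indicator {\<omega>. alive n \<omega>} \<omega> :: real) borel (X n)" for n
  proof -
    \<comment> \<open>Being alive at time \<open>n\<close> depends on the first \<open>n\<close> steps alone. The guard \<open>j < n\<close> makes
      the test measurable on the product over \<open>{..<n}\<close>, term by term.\<close>
    let ?g = "\<lambda>x :: nat \<Rightarrow> real.
      indicator {x. \<forall>k\<in>{1..n}. (\<Sum>j<k. if j < n then x j else 0) > 0} x :: real"
    have [measurable]: "(\<lambda>x. if j < n then x j else 0) \<in> borel_measurable (PiM {..<n} (\<lambda>_. borel :: real measure))" for j
      by (cases "j < n") auto
    have "indep_var borel (?g \<circ> (\<lambda>\<omega>. restrict (\<lambda>i. X i \<omega>) {..<n}))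
        borel ((\<lambda>x. x n) \<circ> (\<lambda>\<omega>. restrict (\<lambda>i. X i \<omega>) {n}))"
      by (rule indep_var_compose[OF indep_var_restrict[OF indep]]) (auto, measurable)
    also have "?g \<circ> (\<lambda>\<omega>. restrict (\<lambda>i. X i \<omega>) {..<n}) = (\<lambda>\<omega>. indicator {\<omega>. alive n \<omega>} \<omega>)"
    proof
      fix \<omega>
      have "(\<Sum>j<k. if j < n then restrict (\<lambda>i. X i \<omega>) {..<n} j else 0) = S k \<omega>" if "k \<in> {1..n}" for k
        unfolding S_def using that by (intro sum.cong) auto
      then have "alive n \<omega> \<longleftrightarrow>
          (\<forall>k\<in>{1..n}. (\<Sum>j<k. if j < n then restrict (\<lambda>i. X i \<omega>) {..<n} j else 0) > 0)"
        unfolding alive_def by (intro ball_cong) (simp_all only:)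
      then show "(?g \<circ> (\<lambda>\<omega>. restrict (\<lambda>i. X i \<omega>) {..<n})) \<omega> = indicator {\<omega>. alive n \<omega>} \<omega>"
        by (simp only: comp_def indicator_def mem_Collect_eq)
    qed
    finally show ?thesis by (simp add: comp_def)
  qed
  have G_step: "G (Suc n) \<omega> = G n \<omega> + indicator {\<omega>. alive (Suc n) \<omega>} \<omega> * X (Suc n) \<omega>"
    if \<omega>: "\<omega> \<in> space M" for n \<omega>
  proof (cases "alive (Suc n) \<omega>")
    case True
    then have "S (Suc n) \<omega> > 0" by (simp add: alive_def)
    \<comment> \<open>Integrality: one further step cannot jump over zero.\<close>
    then have "S (Suc n) \<omega> \<ge> 1"
      using S_Ints[OF \<omega>, of "Suc n"] by (auto elim!: Ints_cases)
    moreover have "S (Suc (Suc n)) \<omega> = S (Suc n) \<omega> + X (Suc n) \<omega>"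
      by (simp add: S_def)
    moreover have "alive (Suc (Suc n)) \<omega> \<longleftrightarrow> S (Suc (Suc n)) \<omega> > 0"
      using True by (auto simp: alive_def le_Suc_eq)
    ultimately show ?thesis
      using True range[OF \<omega>, of "Suc n"] by (auto simp: G_def)
  next
    case False
    then have "\<not> alive (Suc (Suc n)) \<omega>" by (auto simp: alive_def)
    with False show ?thesis by (simp add: G_def)
  qed
  have X_int: "integrable M (X n)" for n
  proof (rule integrable_const_bound[where B = 1])
    show "AE x in M. norm (X n x) \<le> 1"
      using range[of _ n] by (intro AE_I2) force
  qed simp
  have G_mean: "expectation (G n) \<ge> prob {\<omega> \<in> space M. X 0 \<omega> = 1}" for n
  proof (induction n)
    case 0
    have "expectation (G 0) = expectation (indicator {\<omega> \<in> space M. X 0 \<omega> = 1})"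
    proof (rule Bochner_Integration.integral_cong[OF refl])
      fix \<omega> assume "\<omega> \<in> space M"
      then show "G 0 \<omega> = indicator {\<omega> \<in> space M. X 0 \<omega> = 1} \<omega>"
        using range[of \<omega> 0] by (auto simp: G_def alive_def S_def indicator_def)
    qed
    then show ?case by simp
  next
    case (Suc n)
    let ?I = "\<lambda>\<omega>. indicator {\<omega>. alive (Suc n) \<omega>} \<omega> :: real"
    have I_int: "integrable M ?I"
      by (intro integrable_const_bound[where B = 1] AE_I2) (auto simp: indicator_def)
    note indep_prod = alive_indep[of "Suc n"]
    have "expectation (G (Suc n)) = expectation (\<lambda>\<omega>. G n \<omega> + ?I \<omega> * X (Suc n) \<omega>)"
      by (intro Bochner_Integration.integral_cong refl G_step)
    also have "\<dots> = expectation (G n) + expectation ?I * expectation (X (Suc n))"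
      using indep_var_integrable[OF indep_prod I_int X_int]
        indep_var_lebesgue_integral[OF indep_prod I_int X_int] G_int[of n] by simp
    also have "\<dots> \<ge> expectation (G n)"
      using drift by (simp add: integral_nonneg_AE)
    finally show ?case using Suc.IH by linarith
  qed
  have G_le_T: "ennreal (G n \<omega>) \<le> T \<omega>" if \<omega>: "\<omega> \<in> space M" for n \<omega>
  proof (cases "alive (Suc n) \<omega>")
    case True
    show ?thesis unfolding T_def
    proof (rule INF_greatest)
      fix m assume "m \<in> {n. n \<ge> 1 \<and> (\<Sum>k<n. X k \<omega>) = 0}"
      then have m: "m \<ge> 1" "(\<Sum>k<m. X k \<omega>) = 0" by auto
      then have "m \<notin> {1..Suc n}" using True unfolding alive_def S_def by fastforce
      then have "\<not> m \<le> Suc n" using m by simp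
      then have "G n \<omega> \<le> real m"
        using G_le[OF \<omega>, of n] by linarith
      then show "ennreal (G n \<omega>) \<le> of_nat m"
        using ennreal_leI ennreal_of_nat_eq_real_of_nat by metis
    qed
  qed (simp add: G_def)
  have "AE \<omega> in M. T \<omega> \<noteq> \<infinity>"
    using T_fin by (intro nn_integral_PInf_AE) auto
  then have "AE \<omega> in M. (\<lambda>n. ennreal (G n \<omega>)) \<longlonglongrightarrow> 0"
  proof eventually_elim
    case (elim \<omega>)
    then obtain m where m: "m \<ge> 1" "S m \<omega> = 0"
      unfolding T_def S_def by (metis (mono_tags, lifting) INF_top_conv(2) infinity_ennreal_def mem_Collect_eq)
    have "G n \<omega> = 0" if "n \<ge> m" for n
      using m that by (force simp: G_def alive_def)
    then show "(\<lambda>n. ennreal (G n \<omega>)) \<longlonglongrightarrow> 0"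
      by (intro tendsto_eventually eventually_sequentiallyI[of m]) simp
  qed
  then have "(\<lambda>n. \<integral>\<^sup>+ \<omega>. ennreal (G n \<omega>) \<partial>M) \<longlonglongrightarrow> (\<integral>\<^sup>+ \<omega>. 0 \<partial>M)"
    using G_le_T T_fin by (intro nn_integral_dominated_convergence[where w = T]) auto
  moreover have "(\<integral>\<^sup>+ \<omega>. ennreal (G n \<omega>) \<partial>M) \<ge> ennreal (prob {\<omega> \<in> space M. X 0 \<omega> = 1})" for n
    using G_mean[of n] G_int[of n] G_nonneg by (subst nn_integral_eq_integral) (auto intro: ennreal_leI)
  ultimately have "ennreal (prob {\<omega> \<in> space M. X 0 \<omega> = 1}) \<le> 0"
    by (intro LIMSEQ_le_const[of _ 0]) auto
  with up show False by (simp add: ennreal_eq_0_iff)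
qed

section \<open>Conserved weights of the queue\<close>

text \<open>A hyperedge completed by storing the item would contain its class, and then choosing one stored item for each other class would give a match.\<close>

lemma unmatched_arrival_in_queue_words:
  assumes w: "w \<in> queue_words V E" and c: "c \<in> V" and none: "possible_matches E w c = {}"
  shows "w @ [c] \<in> queue_words V E"
proof -
  have "\<not> H \<subseteq> set (w @ [c])" if H: "H \<in> E" for H
  proof
    assume sub: "H \<subseteq> set (w @ [c])"
    from w H have "\<not> H \<subseteq> set w" by (auto simp: queue_words_def)
    with sub have "c \<in> H" by auto
    have "set w = nth w ` {..<length w}"
      by (auto simp: set_conv_nth)
    with sub have "H - {c} \<subseteq> nth w ` {..<length w}"
      by auto
    then obtain I where "I \<subseteq> {..<length w}" "inj_on (nth w) I" "H - {c} = nth w ` I"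
      by (meson subset_image_inj)
    moreover from this have "c \<notin> nth w ` I" "insert c (nth w ` I) = H"
      using \<open>c \<in> H\<close> by auto
    ultimately have "I \<in> possible_matches E w c"
      using H by (simp add: possible_matches_def)
    with none show False by simp
  qed
  with w c show ?thesis by (auto simp: queue_words_def)
qed

lemma sum_list_nths:
  fixes f :: "'a \<Rightarrow> 'b :: comm_monoid_add"
  shows "sum_list (map f (nths w I)) = (\<Sum>i\<in>{..<length w} \<inter> I. f (w ! i))"
proof (induction w rule: rev_induct)
  case (snoc x w)
  have "{..<length (w @ [x])} \<inter> I
      = ({..<length w} \<inter> I) \<union> (if length w \<in> I then {length w} else {})"
    by (auto simp: less_Suc_eq)
  moreover have "(\<Sum>i\<in>{..<length w} \<inter> I. f ((w @ [x]) ! i)) = (\<Sum>i\<in>{..<length w} \<inter> I. f (w ! i))"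
    by (intro sum.cong) (auto simp: nth_append)
  ultimately show ?case
    using snoc by (auto simp: nths_append add.commute)
qed simp

text \<open>The removed items weigh \<open>- f c\<close>, because together with the incoming item they form a
  hyperedge: a match changes the weight of the buffer exactly as storing the item would.\<close>

lemma match_weight:
  fixes f :: "'v \<Rightarrow> real"
  assumes bal: "\<And>H. H \<in> E \<Longrightarrow> (\<Sum>v\<in>H. f v) = 0" and I: "I \<in> possible_matches E w c"
  shows "sum_list (map f (nths w (- I))) = sum_list (map f w) + f c"
proof -
  from I have I': "I \<subseteq> {..<length w}" "inj_on (nth w) I" "c \<notin> nth w ` I" "insert c (nth w ` I) \<in> E"
    by (auto simp: possible_matches_def)
  then have fin: "finite I" by (meson finite_lessThan finite_subset)
  have "0 = f c + (\<Sum>v\<in>nth w ` I. f v)"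
    using bal[OF I'(4)] I'(3) fin by simp
  also have "(\<Sum>v\<in>nth w ` I. f v) = (\<Sum>i\<in>I. f (w ! i))"
    using I'(2) by (simp add: sum.reindex)
  finally have "(\<Sum>i\<in>I. f (w ! i)) = - f c" by simp
  moreover have "sum_list (map f w) = (\<Sum>i<length w. f (w ! i))"
    using sum_list_nths[of f w UNIV] by (simp add: nths_all)
  moreover have "(\<Sum>i<length w. f (w ! i)) = (\<Sum>i\<in>{..<length w} - I. f (w ! i)) + (\<Sum>i\<in>I. f (w ! i))"
    using I'(1) by (intro sum.subset_diff) auto
  ultimately show ?thesis
    by (simp add: sum_list_nths Diff_eq)
qed

text \<open>The policy does not occur in the sum over the arrivals; this is what makes the bound on return
  times uniform in the policy. Membership in the queue details has to be carried along, since
  admissibility constrains the policy on these words only.\<close>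

lemma queue_weight:
  fixes f :: "'v \<Rightarrow> real"
  assumes adm: "admissible V E \<Phi>" and bal: "\<And>H. H \<in> E \<Longrightarrow> (\<Sum>v\<in>H. f v) = 0"
    and w: "w \<in> queue_words V E"
    and \<omega>: "\<And>n. fst (\<omega> n) \<in> V" "\<And>n. snd (\<omega> n) \<in> space unif01"
  shows "queue E \<Phi> w \<omega> n \<in> queue_words V E"
    and "sum_list (map f (queue E \<Phi> w \<omega> n)) = sum_list (map f w) + (\<Sum>k<n. f (fst (\<omega> k)))"
proof (induction n)
  case 0
  case 1 show ?case using w by simp
next
  case 0
  case 2 show ?case by simp
next
  case (Suc n)
  let ?w = "queue E \<Phi> w \<omega> n"
  obtain c u where cu: "\<omega> n = (c, u)" by force
  have c: "c \<in> V" and u: "u \<in> space unif01" using \<omega>[of n] cu by auto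
  have match: "\<Phi> ?w c u \<in> possible_matches E ?w c" if "possible_matches E ?w c \<noteq> {}"
  proof -
    have "\<Phi> ?w c \<in> unif01 \<rightarrow>\<^sub>M count_space (possible_matches E ?w c)"
      using adm Suc(1) c that unfolding admissible_def by blast
    from measurable_space[OF this u] show ?thesis by simp
  qed
  case 1
  show ?case
  proof (cases "possible_matches E ?w c = {}")
    case True
    then show ?thesis
      using unmatched_arrival_in_queue_words[OF Suc(1) c] by (simp add: queue_step_def cu)
  next
    case False
    have "set (nths ?w (- \<Phi> ?w c u)) \<subseteq> set ?w"
      by (rule set_nths_subset)
    with Suc(1) have "nths ?w (- \<Phi> ?w c u) \<in> queue_words V E"
      unfolding queue_words_def in_lists_conv_set by blast
    with False show ?thesis by (simp add: queue_step_def cu)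
  qed
  case 2
  show ?case
    using Suc(2) match_weight[of E f, OF bal match] by (auto simp: queue_step_def cu)
qed

section \<open>The arrival process\<close>

lemma prob_space_unif01: "prob_space unif01"
  unfolding unif01_def by (rule prob_space_restrict_space) auto

lemma prob_space_class_law:
  assumes "set_pmf \<mu> = V"
  shows "prob_space (restrict_space (measure_pmf \<mu>) V)"
  using assms by (intro prob_space_restrict_space) (auto simp: measure_pmf.emeasure_eq_1_AE AE_measure_pmf)

lemma prob_space_arrivals:
  assumes "set_pmf \<mu> = V"
  shows "prob_space (arrivals V \<mu>)"
  unfolding arrivals_def
  by (intro prob_space_PiM prob_space_pair prob_space_class_law prob_space_unif01 assms)

lemma class_measurable [measurable]:
  "(\<lambda>\<omega>. fst (\<omega> n)) \<in> arrivals V \<mu> \<rightarrow>\<^sub>M restrict_space (measure_pmf \<mu>) V"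
  unfolding arrivals_def by measurable

text \<open>The class of each arrival has law \<open>\<mu>\<close>, here as a measure on its support: first the
  coordinate \<open>n\<close> of the infinite product, then the first component of the pair.\<close>

lemma class_distr:
  assumes "set_pmf \<mu> = V"
  shows "distr (arrivals V \<mu>) (restrict_space (measure_pmf \<mu>) V) (\<lambda>\<omega>. fst (\<omega> n))
    = restrict_space (measure_pmf \<mu>) V" (is "_ = ?R")
proof -
  interpret U: prob_space unif01 by (rule prob_space_unif01)
  have ps: "prob_space (?R \<Otimes>\<^sub>M unif01)"
    by (intro prob_space_pair prob_space_class_law prob_space_unif01 assms)
  have "distr (arrivals V \<mu>) ?R (\<lambda>\<omega>. fst (\<omega> n))
      = distr (distr (arrivals V \<mu>) (?R \<Otimes>\<^sub>M unif01) (\<lambda>\<omega>. \<omega> n)) ?R fst"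
    by (subst distr_distr) (auto simp: arrivals_def comp_def)
  also have "\<dots> = ?R"
    using ps distr_PiM_component[of UNIV "\<lambda>_. ?R \<Otimes>\<^sub>M unif01" n]
    by (simp add: arrivals_def U.distr_pair_fst)
  finally show ?thesis .
qed

lemma class_weight_measurable:
  fixes f :: "'v \<Rightarrow> real"
  shows "f \<in> borel_measurable (restrict_space (measure_pmf \<mu>) V)"
  by (intro measurable_restrict_space1) simp

lemma expectation_class:
  fixes f :: "'v \<Rightarrow> real"
  assumes "set_pmf \<mu> = V"
  shows "(\<integral>\<omega>. f (fst (\<omega> n)) \<partial>arrivals V \<mu>) = measure_pmf.expectation \<mu> f"
proof -
  let ?R = "restrict_space (measure_pmf \<mu>) V"
  have "(\<integral>\<omega>. f (fst (\<omega> n)) \<partial>arrivals V \<mu>) = (\<integral>v. f v \<partial>?R)"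
    using integral_distr[OF class_measurable class_weight_measurable, of V \<mu> n f]
    by (simp add: class_distr[OF assms])
  also have "\<dots> = (\<integral>v. indicator V v *\<^sub>R f v \<partial>measure_pmf \<mu>)"
    by (rule integral_restrict_space) simp
  also have "\<dots> = measure_pmf.expectation \<mu> f"
    using assms by (intro integral_cong_AE) (auto simp: AE_measure_pmf_iff)
  finally show ?thesis .
qed

lemma indep_class_weights:
  fixes f :: "'v \<Rightarrow> real"
  assumes "set_pmf \<mu> = V"
  shows "prob_space.indep_vars (arrivals V \<mu>) (\<lambda>_. borel) (\<lambda>n \<omega>. f (fst (\<omega> n))) UNIV"
proof -
  let ?N = "restrict_space (measure_pmf \<mu>) V \<Otimes>\<^sub>M unif01"
  interpret prob_space "arrivals V \<mu>" by (rule prob_space_arrivals[OF assms])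
  have ps: "prob_space ?N"
    by (intro prob_space_pair prob_space_class_law prob_space_unif01 assms)
  have meas: "(\<lambda>\<omega>. \<omega> n) \<in> arrivals V \<mu> \<rightarrow>\<^sub>M ?N" for n
    unfolding arrivals_def by measurable
  have "indep_vars (\<lambda>_. ?N) (\<lambda>n \<omega>. \<omega> n) UNIV"
    using meas ps distr_PiM_component[of "UNIV :: nat set" "\<lambda>_. ?N"]
    by (subst indep_vars_iff_distr_eq_PiM)
      (simp_all add: arrivals_def restrict_UNIV distr_id2)
  moreover have "(\<lambda>p. f (fst p)) \<in> borel_measurable ?N"
    using class_weight_measurable by measurable
  ultimately show ?thesis
    by (intro indep_vars_compose2[where Y = "\<lambda>_ p. f (fst p)"]) auto
qed

section \<open>Balanced weights rule out stability\<close>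

text \<open>The empty word is a state whose expected return time is infinite. For an
  arbitrary policy its return time is only compared pointwise with that of the walk: the upper
  function in a monotonicity argument may be nonmeasurable.\<close>

lemma nonneg_mean_balanced_weight_not_stable:
  fixes f :: "'v \<Rightarrow> real"
  assumes adm: "admissible V E \<Phi>" and supp: "set_pmf \<mu> = V" and ne: "{} \<notin> E"
    and bal: "\<And>H. H \<in> E \<Longrightarrow> (\<Sum>v\<in>H. f v) = 0"
    and range: "\<And>v. f v \<in> {-1, 0, 1}"
    and mean: "measure_pmf.expectation \<mu> f \<ge> 0"
    and up: "v \<in> V" "f v = 1"
  shows "\<not> stable V E \<Phi> \<mu>"
proof -
  let ?A = "arrivals V \<mu>"
  interpret prob_space ?A by (rule prob_space_arrivals[OF supp])
  have empty: "[] \<in> queue_words V E"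
    using ne by (auto simp: queue_words_def)
  have "prob {\<omega> \<in> space ?A. f (fst (\<omega> 0)) = 1}
      = expectation (indicator {\<omega> \<in> space ?A. f (fst (\<omega> 0)) = 1})"
    by (auto intro!: arg_cong[where f = prob])
  also have "\<dots> = expectation (\<lambda>\<omega>. indicator {v. f v = 1} (fst (\<omega> 0)))"
    by (intro Bochner_Integration.integral_cong) (auto simp: indicator_def)
  also have "\<dots> = measure_pmf.prob \<mu> {v. f v = 1}"
    by (simp add: expectation_class[OF supp])
  also have "\<dots> > 0"
    using up supp by (intro measure_pmf_posI[of v]) auto
  finally have "\<infinity> = (\<integral>\<^sup>+ \<omega>. (INF n\<in>{n. n \<ge> 1 \<and> (\<Sum>k<n. f (fst (\<omega> k))) = 0}. of_nat n) \<partial>?A)"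
    using range mean
    by (intro nonneg_drift_walk_infinite_expected_return[symmetric] indep_class_weights supp)
      (auto simp: expectation_class[OF supp])
  also have "\<dots> \<le> (\<integral>\<^sup>+ \<omega>. return_time E \<Phi> [] \<omega> \<partial>?A)"
  proof (intro nn_integral_mono)
    fix \<omega> assume "\<omega> \<in> space ?A"
    then have \<omega>: "fst (\<omega> n) \<in> V" "snd (\<omega> n) \<in> space unif01" for n
      by (auto simp: arrivals_def space_PiM PiE_iff space_pair_measure space_restrict_space mem_Times_iff)
    show "(INF n\<in>{n. n \<ge> 1 \<and> (\<Sum>k<n. f (fst (\<omega> k))) = 0}. of_nat n) \<le> return_time E \<Phi> [] \<omega>"
      unfolding return_time_def
    proof (rule INF_superset_mono)
      show "{n. n \<ge> 1 \<and> queue E \<Phi> [] \<omega> n = []} \<subseteq> {n. n \<ge> 1 \<and> (\<Sum>k<n. f (fst (\<omega> k))) = 0}"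
      proof safe
        fix n assume "queue E \<Phi> [] \<omega> n = []"
        moreover have "sum_list (map f (queue E \<Phi> [] \<omega> n)) = sum_list (map f []) + (\<Sum>k<n. f (fst (\<omega> k)))"
          by (rule queue_weight(2)[OF adm bal empty \<omega>])
        ultimately show "(\<Sum>k<n. f (fst (\<omega> k))) = 0" by simp
      qed
    qed simp
  qed
  finally have "\<not> (\<integral>\<^sup>+ \<omega>. return_time E \<Phi> [] \<omega> \<partial>?A) < \<infinity>"
    by (simp add: not_less)
  then show ?thesis
    using empty unfolding stable_def by blast
qed

text \<open>A hyperedge through a node of nonzero weight contains weights of both signs, since they sum to
  zero. So \<open>f\<close> and \<open>- f\<close> both take the value \<open>1\<close>, and one of them has nonnegative mean.\<close>

lemma balanced_weight_non_stabilizable: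
  fixes f :: "'v \<Rightarrow> real"
  assumes hyp: "hypergraph V E" and ne: "{} \<notin> E"
    and bal: "\<And>H. H \<in> E \<Longrightarrow> (\<Sum>v\<in>H. f v) = 0"
    and range: "\<And>v. f v \<in> {-1, 0, 1}"
    and nz: "v \<in> V" "f v \<noteq> 0"
  shows "non_stabilizable V E"
proof -
  from hyp have "V = \<Union>E" "finite V"
    by (auto simp: hypergraph_def)
  with nz(1) obtain H where H: "H \<in> E" "v \<in> H" and HV: "H \<subseteq> V"
    by blast
  with \<open>finite V\<close> have fin: "finite H"
    by (meson finite_subset)
  have signs: "f x > 0 \<Longrightarrow> f x = 1" "f x < 0 \<Longrightarrow> - f x = 1" for x
    using range[of x] by auto
  have "\<exists>a\<in>H. f a > 0"
  proof (rule ccontr)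
    assume "\<not> ?thesis"
    then have "(\<Sum>v\<in>H. - f v) = 0 \<longleftrightarrow> (\<forall>v\<in>H. - f v = 0)"
      by (intro sum_nonneg_eq_0_iff fin) (auto simp: not_less)
    with bal[OF H(1)] H(2) nz(2) show False by (simp add: sum_negf)
  qed
  then obtain a where a: "a \<in> V" "f a = 1" using HV signs(1) by blast
  have "\<exists>b\<in>H. f b < 0"
  proof (rule ccontr)
    assume "\<not> ?thesis"
    then have "(\<Sum>v\<in>H. f v) = 0 \<longleftrightarrow> (\<forall>v\<in>H. f v = 0)"
      by (intro sum_nonneg_eq_0_iff fin) (auto simp: not_less)
    with bal[OF H(1)] H(2) nz(2) show False by simp
  qed
  then obtain b where b: "b \<in> V" "- f b = 1" using HV signs(2) by blast
  have "\<not> stable V E \<Phi> \<mu>" if adm: "admissible V E \<Phi>" and supp: "set_pmf \<mu> = V" for \<Phi> \<mu>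
  proof (cases "measure_pmf.expectation \<mu> f \<ge> 0")
    case True
    show ?thesis
      by (rule nonneg_mean_balanced_weight_not_stable[OF adm supp ne bal range True a])
  next
    case False
    have "(\<Sum>v\<in>H. - f v) = 0" if "H \<in> E" for H
      using bal[OF that] by (simp add: sum_negf)
    moreover have "- f x \<in> {-1, 0, 1}" for x
      using range[of x] by auto
    moreover have "measure_pmf.expectation \<mu> (\<lambda>v. - f v) \<ge> 0"
      using False by simp
    ultimately show ?thesis
      using b by (rule nonneg_mean_balanced_weight_not_stable[OF adm supp ne])
  qed
  then show ?thesis
    unfolding non_stabilizable_def Stab_def full_support_def by blast
qed

theorem proposition4p8:
  fixes V :: "'v set" and E :: "'v set set" and r :: nat
  assumes "r \<ge> 2"
    and "hypergraph V E"
    and "simple_hypergraph E"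
    and "connected_hypergraph E"
    and "uniform_hypergraph r E"
    and "partite_hypergraph r V E"
  shows "non_stabilizable V E"
proof -
  obtain P :: "nat \<Rightarrow> 'v set"
    where inj: "inj_on P {1..r}" and part: "partition_on V (P ` {1..r})"
      and meets: "\<forall>H\<in>E. \<forall>i\<in>{1..r}. card (H \<inter> P i) = 1"
    using assms(6) unfolding partite_hypergraph_def by (elim exE conjE) (rule that)
  have idx: "1 \<in> {1..r}" "2 \<in> {1..r}" using assms(1) by auto
  have "P 1 \<noteq> P 2"
    using inj_onD[OF inj _ idx] by linarith
  then have disj: "P 1 \<inter> P 2 = {}"
    using disjointD[OF partition_onD2[OF part]] idx by blast
  have "P 1 \<noteq> {}"
    using partition_onD3[OF part] idx(1) by blast
  moreover have "P 1 \<subseteq> V"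
    using partition_onD1[OF part] idx(1) by blast
  ultimately obtain v where v: "v \<in> V" "v \<in> P 1" by blast
  let ?f = "\<lambda>v. indicator (P 1) v - indicator (P 2) v :: real"
  show ?thesis
  proof (rule balanced_weight_non_stabilizable[of V E ?f v])
    show "{} \<notin> E" using meets idx(1) by force
    show "(\<Sum>v\<in>H. ?f v) = 0" if "H \<in> E" for H
    proof -
      have "finite H"
        using assms(2) that by (auto simp: hypergraph_def intro: finite_subset)
      moreover have "card (H \<inter> P 1) = 1" "card (H \<inter> P 2) = 1"
        using meets that idx by blast+
      ultimately show ?thesis
        by (simp add: sum_subtractf indicator_def sum.If_cases Int_def)
    qed
  qed (use v disj assms(2) in \<open>auto simp: indicator_def\<close>)
qed

end
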